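(* (Completeness) Every valid sequent $\Gamma\Rightarrow\Sigma$ is derivable in the sequent calculus $\mathfrak S$.
   Context: Formulas are built from a denumerable set of propositional variables with binary $\wedge,\vee$, unary $\neg,\nabla$ and constants $\bot,\top$. $\mathbb{S}_6$ is the algebra with universe $\{0,\tfrac13,N,B,\tfrac23,1\}$, lattice order $0<\tfrac13<N<\tfrac23<1$, $\tfrac13<B<\tfrac23$, $N,B$ incomparable; $\neg$ swaps $0\leftrightarrow1$, $\tfrac13\leftrightarrow\tfrac23$, fixes $N,B$; $\nabla0=0$, $\nabla x=1$ for $x\ne0$; homomorphisms from formulas send $\bot\mapsto0,\top\mapsto1$. A sequent is $\Gamma\Rightarrow\Sigma$ with $\Gamma,\Sigma$ finite sets of formulas; it is valid iff $h(\bigwedge\Gamma)\le h(\bigvee\Sigma)$ for every homomorphism $h$ into $\mathbb{S}_6$ (empty conjunction $\top$, empty disjunction $\bot$). $\nabla\Sigma=\{\nabla\beta:\beta\in\Sigma\}$. The calculus $\mathfrak S$ has axioms $\alpha\Rightarrow\alpha$; $\bot\Rightarrow$; $\Rightarrow\top$; $\alpha\Rightarrow\nabla\alpha$; $\Rightarrow\nabla\alpha\vee\neg\nabla\alpha$; and rules (premises / conclusion): left weakening $\Gamma\Rightarrow\Sigma$ / $\Gamma,\alpha\Rightarrow\Sigma$; right weakening $\Gamma\Rightarrow\Sigma$ / $\Gamma\Rightarrow\Sigma,\alpha$; cut $\Gamma\Rightarrow\Sigma,\alpha$ and $\alpha,\Gamma\Rightarrow\Sigma$ / $\Gamma\Rightarrow\Sigma$;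 $(\wedge\Rightarrow)$ $\Gamma,\alpha,\beta\Rightarrow\Sigma$ / $\Gamma,\alpha\wedge\beta\Rightarrow\Sigma$; $(\Rightarrow\wedge)$ $\Gamma\Rightarrow\Sigma,\alpha$ and $\Gamma\Rightarrow\Sigma,\beta$ / $\Gamma\Rightarrow\Sigma,\alpha\wedge\beta$; $(\vee\Rightarrow)$ $\Gamma,\alpha\Rightarrow\Sigma$ and $\Gamma,\beta\Rightarrow\Sigma$ / $\Gamma,\alpha\vee\beta\Rightarrow\Sigma$; $(\Rightarrow\vee)$ $\Gamma\Rightarrow\Sigma,\alpha,\beta$ / $\Gamma\Rightarrow\Sigma,\alpha\vee\beta$; $(\neg)$ $\alpha\Rightarrow\beta$ / $\neg\beta\Rightarrow\neg\alpha$; $(\neg\neg\Rightarrow)$ $\Gamma,\alpha\Rightarrow\Sigma$ / $\Gamma,\neg\neg\alpha\Rightarrow\Sigma$; $(\Rightarrow\neg\neg)$ $\Gamma\Rightarrow\alpha,\Sigma$ / $\Gamma\Rightarrow\neg\neg\alpha,\Sigma$; $(\nabla)$ $\Gamma,\alpha\Rightarrow\nabla\Sigma$ / $\Gamma,\nabla\alpha\Rightarrow\nabla\Sigma$; $(\neg\nabla\Rightarrow)$ $\Gamma,\neg\nabla\alpha\Rightarrow\Sigma$ / $\Gamma,\nabla\neg\nabla\alpha\Rightarrow\Sigma$. Derivability is the usual notion (derivation trees from axiom instances using these rules). *)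

theory Defs
  imports "HOL-Library.FSet"
begin

datatype s6 = Zero | Third | N | B | TwoThirds | One

instantiation s6 :: "{bounded_lattice, distrib_lattice}"
begin

text \<open>
  Third is below everything except Zero and TwoThirds is above everything except One,
  so N and B are the only incomparable pair; their meet is Third and their join is TwoThirds.
\<close>

definition less_eq_s6 :: "s6 \<Rightarrow> s6 \<Rightarrow> bool" where
  "x \<le> y \<longleftrightarrow> x = y \<or> x = Zero \<or> y = One \<or> (x = Third \<and> y \<noteq> Zero) \<or> (x \<noteq> One \<and> y = TwoThirds)"

definition less_s6 :: "s6 \<Rightarrow> s6 \<Rightarrow> bool" where
  "x < y \<longleftrightarrow> x \<le> y \<and> x \<noteq> (y::s6)"

definition inf_s6 :: "s6 \<Rightarrow> s6 \<Rightarrow> s6" where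
  "inf x y = (if x \<le> y then x else if y \<le> x then y else Third)"

definition sup_s6 :: "s6 \<Rightarrow> s6 \<Rightarrow> s6" where
  "sup x y = (if x \<le> y then y else if y \<le> x then x else TwoThirds)"

definition bot_s6 :: s6 where "bot = Zero"

definition top_s6 :: s6 where "top = One"

instance
proof
  fix x y z :: s6
  show "(x < y) = (x \<le> y \<and> \<not> y \<le> x)"
    by (cases x; cases y; simp add: less_s6_def less_eq_s6_def)
  show "x \<le> x"
    by (simp add: less_eq_s6_def)
  show "x \<le> z" if "x \<le> y" "y \<le> z"
    using that by (cases x; cases y; cases z; simp add: less_eq_s6_def)
  show "x = y" if "x \<le> y" "y \<le> x"
    using that by (cases x; cases y; simp add: less_eq_s6_def)
  show "inf x y \<le> x" "inf x y \<le> y"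
    by (cases x; cases y; simp add: inf_s6_def less_eq_s6_def)+
  show "x \<le> inf y z" if "x \<le> y" "x \<le> z"
    using that by (cases x; cases y; cases z; simp add: inf_s6_def less_eq_s6_def)
  show "x \<le> sup x y" "y \<le> sup x y"
    by (cases x; cases y; simp add: sup_s6_def less_eq_s6_def)+
  show "sup y z \<le> x" if "y \<le> x" "z \<le> x"
    using that by (cases x; cases y; cases z; simp add: sup_s6_def less_eq_s6_def)
  show "bot \<le> x" "x \<le> top"
    by (simp_all add: bot_s6_def top_s6_def less_eq_s6_def)
  show "sup x (inf y z) = inf (sup x y) (sup x z)"
    by (cases x; cases y; cases z; simp add: inf_s6_def sup_s6_def less_eq_s6_def)
qed

end

fun neg_s6 :: "s6 \<Rightarrow> s6" where
  "neg_s6 Zero = One"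
| "neg_s6 Third = TwoThirds"
| "neg_s6 N = N"
| "neg_s6 B = B"
| "neg_s6 TwoThirds = Third"
| "neg_s6 One = Zero"

definition nabla_s6 :: "s6 \<Rightarrow> s6" where
  "nabla_s6 x = (if x = Zero then Zero else One)"

datatype form =
    Var nat
  | Bot ("\<^bold>\<bottom>")
  | Top ("\<^bold>\<top>")
  | Neg form ("\<^bold>\<not> _" [70] 70)
  | Nabla form ("\<^bold>\<nabla> _" [70] 70)
  | And form form (infixr "\<^bold>\<and>" 65)
  | Or form form (infixr "\<^bold>\<or>" 60)

definition hom :: "(form \<Rightarrow> s6) \<Rightarrow> bool" where
  "hom h \<longleftrightarrow>
     h \<^bold>\<bottom> = Zero \<and> h \<^bold>\<top> = One \<and>
     (\<forall>\<alpha>. h (\<^bold>\<not> \<alpha>) = neg_s6 (h \<alpha>)) \<and>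
     (\<forall>\<alpha>. h (\<^bold>\<nabla> \<alpha>) = nabla_s6 (h \<alpha>)) \<and>
     (\<forall>\<alpha> \<beta>. h (\<alpha> \<^bold>\<and> \<beta>) = inf (h \<alpha>) (h \<beta>)) \<and>
     (\<forall>\<alpha> \<beta>. h (\<alpha> \<^bold>\<or> \<beta>) = sup (h \<alpha>) (h \<beta>))"

text \<open>
  The conjunction (disjunction) of a finite set of formulas is formed along an arbitrary
  enumeration of the set; the lemmas below show that the choice is irrelevant under every
  homomorphism.
\<close>

definition enum_fset :: "form fset \<Rightarrow> form list" where
  "enum_fset \<Gamma> = (SOME xs. distinct xs \<and> set xs = fset \<Gamma>)"

definition Conj :: "form fset \<Rightarrow> form" where
  "Conj \<Gamma> = foldr And (enum_fset \<Gamma>) \<^bold>\<top>"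

definition Disj :: "form fset \<Rightarrow> form" where
  "Disj \<Sigma> = foldr Or (enum_fset \<Sigma>) \<^bold>\<bottom>"

lemma set_enum_fset: "set (enum_fset \<Gamma>) = fset \<Gamma>"
proof -
  have "\<exists>xs. distinct xs \<and> set xs = fset \<Gamma>"
    using finite_distinct_list[OF finite_fset, of \<Gamma>] by (simp add: conj_commute)
  then show ?thesis
    unfolding enum_fset_def by (rule someI2_ex) simp
qed

lemma le_hom_Conj_iff:
  assumes "hom h"
  shows "x \<le> h (Conj \<Gamma>) \<longleftrightarrow> (\<forall>\<alpha>. \<alpha> |\<in>| \<Gamma> \<longrightarrow> x \<le> h \<alpha>)"
proof -
  have "x \<le> h (foldr And xs \<^bold>\<top>) \<longleftrightarrow> (\<forall>\<alpha>\<in>set xs. x \<le> h \<alpha>)" for xs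
  proof (induction xs)
    case Nil
    then show ?case
      using assms by (simp add: hom_def less_eq_s6_def)
  next
    case (Cons \<beta> xs)
    have "h (\<beta> \<^bold>\<and> foldr And xs \<^bold>\<top>) = inf (h \<beta>) (h (foldr And xs \<^bold>\<top>))"
      using assms unfolding hom_def by blast
    then show ?case
      using Cons by simp
  qed
  then show ?thesis
    by (simp add: Conj_def set_enum_fset Ball_def)
qed

lemma hom_Disj_le_iff:
  assumes "hom h"
  shows "h (Disj \<Sigma>) \<le> x \<longleftrightarrow> (\<forall>\<alpha>. \<alpha> |\<in>| \<Sigma> \<longrightarrow> h \<alpha> \<le> x)"
proof -
  have "h (foldr Or xs \<^bold>\<bottom>) \<le> x \<longleftrightarrow> (\<forall>\<alpha>\<in>set xs. h \<alpha> \<le> x)" for xs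
  proof (induction xs)
    case Nil
    then show ?case
      using assms by (simp add: hom_def less_eq_s6_def)
  next
    case (Cons \<beta> xs)
    have "h (\<beta> \<^bold>\<or> foldr Or xs \<^bold>\<bottom>) = sup (h \<beta>) (h (foldr Or xs \<^bold>\<bottom>))"
      using assms unfolding hom_def by blast
    then show ?case
      using Cons by simp
  qed
  then show ?thesis
    by (simp add: Disj_def set_enum_fset Ball_def)
qed

datatype sequent = Sequent "form fset" "form fset" (infix "\<rhd>" 55)

fun valid :: "sequent \<Rightarrow> bool" where
  "valid (\<Gamma> \<rhd> \<Sigma>) \<longleftrightarrow> (\<forall>h. hom h \<longrightarrow> h (Conj \<Gamma>) \<le> h (Disj \<Sigma>))"

inductive derivable :: "sequent \<Rightarrow> bool" where
  Ax: "derivable ({|\<alpha>|} \<rhd> {|\<alpha>|})"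
| BotL: "derivable ({|\<^bold>\<bottom>|} \<rhd> {||})"
| TopR: "derivable ({||} \<rhd> {|\<^bold>\<top>|})"
| AxNabla: "derivable ({|\<alpha>|} \<rhd> {|\<^bold>\<nabla> \<alpha>|})"
| NablaEM: "derivable ({||} \<rhd> {|\<^bold>\<nabla> \<alpha> \<^bold>\<or> \<^bold>\<not> (\<^bold>\<nabla> \<alpha>)|})"
| WeakL: "derivable (\<Gamma> \<rhd> \<Sigma>) \<Longrightarrow> derivable (finsert \<alpha> \<Gamma> \<rhd> \<Sigma>)"
| WeakR: "derivable (\<Gamma> \<rhd> \<Sigma>) \<Longrightarrow> derivable (\<Gamma> \<rhd> finsert \<alpha> \<Sigma>)"
| Cut: "derivable (\<Gamma> \<rhd> finsert \<alpha> \<Sigma>) \<Longrightarrow> derivable (finsert \<alpha> \<Gamma> \<rhd> \<Sigma>) \<Longrightarrow> derivable (\<Gamma> \<rhd> \<Sigma>)"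
| AndL: "derivable (finsert \<alpha> (finsert \<beta> \<Gamma>) \<rhd> \<Sigma>) \<Longrightarrow> derivable (finsert (\<alpha> \<^bold>\<and> \<beta>) \<Gamma> \<rhd> \<Sigma>)"
| AndR: "derivable (\<Gamma> \<rhd> finsert \<alpha> \<Sigma>) \<Longrightarrow> derivable (\<Gamma> \<rhd> finsert \<beta> \<Sigma>) \<Longrightarrow>
    derivable (\<Gamma> \<rhd> finsert (\<alpha> \<^bold>\<and> \<beta>) \<Sigma>)"
| OrL: "derivable (finsert \<alpha> \<Gamma> \<rhd> \<Sigma>) \<Longrightarrow> derivable (finsert \<beta> \<Gamma> \<rhd> \<Sigma>) \<Longrightarrow>
    derivable (finsert (\<alpha> \<^bold>\<or> \<beta>) \<Gamma> \<rhd> \<Sigma>)"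
| OrR: "derivable (\<Gamma> \<rhd> finsert \<alpha> (finsert \<beta> \<Sigma>)) \<Longrightarrow> derivable (\<Gamma> \<rhd> finsert (\<alpha> \<^bold>\<or> \<beta>) \<Sigma>)"
| NegC: "derivable ({|\<alpha>|} \<rhd> {|\<beta>|}) \<Longrightarrow> derivable ({|\<^bold>\<not> \<beta>|} \<rhd> {|\<^bold>\<not> \<alpha>|})"
| NegNegL: "derivable (finsert \<alpha> \<Gamma> \<rhd> \<Sigma>) \<Longrightarrow> derivable (finsert (\<^bold>\<not> (\<^bold>\<not> \<alpha>)) \<Gamma> \<rhd> \<Sigma>)"
| NegNegR: "derivable (\<Gamma> \<rhd> finsert \<alpha> \<Sigma>) \<Longrightarrow> derivable (\<Gamma> \<rhd> finsert (\<^bold>\<not> (\<^bold>\<not> \<alpha>)) \<Sigma>)"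
| NablaL: "derivable (finsert \<alpha> \<Gamma> \<rhd> Nabla |`| \<Sigma>) \<Longrightarrow>
    derivable (finsert (\<^bold>\<nabla> \<alpha>) \<Gamma> \<rhd> Nabla |`| \<Sigma>)"
| NegNablaL: "derivable (finsert (\<^bold>\<not> (\<^bold>\<nabla> \<alpha>)) \<Gamma> \<rhd> \<Sigma>) \<Longrightarrow>
    derivable (finsert (\<^bold>\<nabla> (\<^bold>\<not> (\<^bold>\<nabla> \<alpha>))) \<Gamma> \<rhd> \<Sigma>)"

end

theory Submission
  imports Defs
begin

text \<open>
  An underivable sequent extends, by Zorn, to a prime theory \<open>P\<close> that contains the antecedent
  and misses the succedent. Put \<open>Q = {\<alpha>. \<nabla>\<alpha> \<in> P}\<close> and write \<open>X\<^sup>* = {\<alpha>. \<not>\<alpha> \<notin> X}\<close> (the Routley star).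
  Then \<open>P\<close>, \<open>P\<^sup>*\<close>, \<open>Q\<close>, \<open>Q\<^sup>*\<close> are prime, \<open>Q\<^sup>*\<close> is contained in \<open>P\<close> and \<open>P\<^sup>*\<close>, and both of these
  are contained in \<open>Q\<close>: this is the shape of the four prime filters generated by 1, \<open>N\<close>, \<open>B\<close>
  and 1/3. Sending a formula to its membership pattern is therefore a homomorphism
  into the six-element algebra; it maps \<open>P\<close> into the filter above \<open>N\<close> and the complement of
  \<open>P\<close> into the ideal below \<open>B\<close>, and \<open>N\<close> is not below \<open>B\<close>.
\<close>

section \<open>Derived sequents\<close>

lemma derivable_weaken:
  assumes "derivable (\<Gamma> \<rhd> \<Delta>)" "\<Gamma> |\<subseteq>| \<Gamma>'" "\<Delta> |\<subseteq>| \<Delta>'"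
  shows "derivable (\<Gamma>' \<rhd> \<Delta>')"
proof -
  have "derivable (\<Theta> |\<union>| \<Gamma> \<rhd> \<Delta>)" for \<Theta>
    by (induction \<Theta>) (simp_all add: assms(1) WeakL)
  then have "derivable (\<Theta> |\<union>| \<Gamma> \<rhd> \<Xi> |\<union>| \<Delta>)" for \<Theta> \<Xi>
    by (induction \<Xi>) (simp_all add: WeakR)
  from this[of \<Gamma>' \<Delta>'] show ?thesis
    using assms(2,3) by (simp add: sup.absorb1)
qed

lemma derivable_common: "\<alpha> |\<in>| \<Gamma> \<Longrightarrow> \<alpha> |\<in>| \<Delta> \<Longrightarrow> derivable (\<Gamma> \<rhd> \<Delta>)"
  by (rule derivable_weaken[OF Ax[of \<alpha>]]) auto

text \<open>\<open>NegC\<close> admits no side formulas, so the laws of negation are derived between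
  single formulas.\<close>

abbreviation entails :: "form \<Rightarrow> form \<Rightarrow> bool" (infix "\<turnstile>" 50) where
  "\<alpha> \<turnstile> \<beta> \<equiv> derivable ({|\<alpha>|} \<rhd> {|\<beta>|})"

lemma entails_trans:
  assumes "\<alpha> \<turnstile> \<beta>" "\<beta> \<turnstile> \<gamma>"
  shows "\<alpha> \<turnstile> \<gamma>"
  by (rule Cut[of _ \<beta>]; rule derivable_weaken[OF assms(1)] derivable_weaken[OF assms(2)]; force)

lemma and_entails: "\<alpha> \<^bold>\<and> \<beta> \<turnstile> \<alpha>" "\<alpha> \<^bold>\<and> \<beta> \<turnstile> \<beta>"
  by (auto intro: AndL derivable_common)

lemma and_intro: "derivable ({|\<alpha>, \<beta>|} \<rhd> {|\<alpha> \<^bold>\<and> \<beta>|})"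
  by (auto intro: AndR derivable_common)

lemma entails_and: "\<gamma> \<turnstile> \<alpha> \<Longrightarrow> \<gamma> \<turnstile> \<beta> \<Longrightarrow> \<gamma> \<turnstile> \<alpha> \<^bold>\<and> \<beta>"
  by (rule AndR)

lemma entails_or: "\<alpha> \<turnstile> \<alpha> \<^bold>\<or> \<beta>" "\<beta> \<turnstile> \<alpha> \<^bold>\<or> \<beta>"
  by (auto intro: OrR derivable_common)

lemma or_elim: "derivable ({|\<alpha> \<^bold>\<or> \<beta>|} \<rhd> {|\<alpha>, \<beta>|})"
  by (auto intro: OrL derivable_common)

lemma or_entails: "\<alpha> \<turnstile> \<gamma> \<Longrightarrow> \<beta> \<turnstile> \<gamma> \<Longrightarrow> \<alpha> \<^bold>\<or> \<beta> \<turnstile> \<gamma>"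
  by (rule OrL)

lemma bot_entails: "\<^bold>\<bottom> \<turnstile> \<alpha>"
  by (rule WeakR[OF BotL])

lemma entails_top: "\<alpha> \<turnstile> \<^bold>\<top>"
  by (rule WeakL[OF TopR])

section \<open>Double negation and De Morgan laws\<close>

lemma neg_neg_entails: "\<^bold>\<not> (\<^bold>\<not> \<alpha>) \<turnstile> \<alpha>"
  by (rule NegNegL[OF Ax])

lemma entails_neg_neg: "\<alpha> \<turnstile> \<^bold>\<not> (\<^bold>\<not> \<alpha>)"
  by (rule NegNegR[OF Ax])

lemma neg_entails_swap: "\<^bold>\<not> \<alpha> \<turnstile> \<beta> \<Longrightarrow> \<^bold>\<not> \<beta> \<turnstile> \<alpha>"
  by (meson NegC entails_trans neg_neg_entails)

lemma entails_neg_swap: "\<alpha> \<turnstile> \<^bold>\<not> \<beta> \<Longrightarrow> \<beta> \<turnstile> \<^bold>\<not> \<alpha>"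
  by (meson NegC entails_trans entails_neg_neg)

lemma neg_top_entails: "\<^bold>\<not> \<^bold>\<top> \<turnstile> \<^bold>\<bottom>"
  by (rule neg_entails_swap[OF entails_top])

lemma entails_neg_bot: "\<^bold>\<top> \<turnstile> \<^bold>\<not> \<^bold>\<bottom>"
  by (rule entails_neg_swap[OF bot_entails])

text \<open>This is the half of De Morgan that needs double negation. Swapping the negation to the
  other side leaves a conjunction to derive, and each conjunct swaps back to a disjunction
  introduction.\<close>

lemma neg_and_entails: "\<^bold>\<not> (\<alpha> \<^bold>\<and> \<beta>) \<turnstile> \<^bold>\<not> \<alpha> \<^bold>\<or> \<^bold>\<not> \<beta>"
  by (intro neg_entails_swap[of "\<^bold>\<not> \<alpha> \<^bold>\<or> \<^bold>\<not> \<beta>"] entails_and)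
    (rule neg_entails_swap[OF entails_or(1)], rule neg_entails_swap[OF entails_or(2)])

lemma entails_neg_or: "\<^bold>\<not> \<alpha> \<^bold>\<and> \<^bold>\<not> \<beta> \<turnstile> \<^bold>\<not> (\<alpha> \<^bold>\<or> \<beta>)"
  by (intro entails_neg_swap[of "\<alpha> \<^bold>\<or> \<beta>"] or_entails)
    (rule entails_neg_swap[OF and_entails(1)], rule entails_neg_swap[OF and_entails(2)])

section \<open>Sequents for nabla\<close>

lemma nabla_entails: "\<alpha> \<turnstile> \<^bold>\<nabla> \<beta> \<Longrightarrow> \<^bold>\<nabla> \<alpha> \<turnstile> \<^bold>\<nabla> \<beta>"
  using NablaL[of \<alpha> "{||}" "{|\<beta>|}"] by simp

lemma nabla_mono: "\<alpha> \<turnstile> \<beta> \<Longrightarrow> \<^bold>\<nabla> \<alpha> \<turnstile> \<^bold>\<nabla> \<beta>"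
  by (rule nabla_entails) (rule entails_trans[OF _ AxNabla])

lemma nabla_and_intro: "derivable ({|\<^bold>\<nabla> \<alpha>, \<^bold>\<nabla> \<beta>|} \<rhd> {|\<^bold>\<nabla> (\<alpha> \<^bold>\<and> \<beta>)|})"
proof -
  have "derivable ({|\<alpha>, \<beta>|} \<rhd> Nabla |`| {|\<alpha> \<^bold>\<and> \<beta>|})"
    by (rule Cut[of _ "\<alpha> \<^bold>\<and> \<beta>"])
      (auto intro: derivable_weaken[OF and_intro] derivable_weaken[OF AxNabla])
  \<comment> \<open>\<open>NablaL\<close> keeps any left context but wants a succedent of nabla
    formulas, so the antecedent formulas can be prefixed one after the other.\<close>
  then have "derivable ({|\<beta>, \<^bold>\<nabla> \<alpha>|} \<rhd> Nabla |`| {|\<alpha> \<^bold>\<and> \<beta>|})"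
    by (subst finsert_commute) (rule NablaL)
  then show ?thesis
    using NablaL[of \<beta> "{|\<^bold>\<nabla> \<alpha>|}" "{|\<alpha> \<^bold>\<and> \<beta>|}"] by (simp add: finsert_commute)
qed

text \<open>Here it matters that \<open>NablaL\<close> allows several nabla formulas on the
  right.\<close>

lemma nabla_or_elim: "derivable ({|\<^bold>\<nabla> (\<alpha> \<^bold>\<or> \<beta>)|} \<rhd> {|\<^bold>\<nabla> \<alpha>, \<^bold>\<nabla> \<beta>|})"
proof -
  have "derivable ({|\<alpha> \<^bold>\<or> \<beta>|} \<rhd> Nabla |`| {|\<alpha>, \<beta>|})"
    by (rule OrL) (auto intro: derivable_weaken[OF AxNabla])
  then show ?thesis
    using NablaL[of "\<alpha> \<^bold>\<or> \<beta>" "{||}" "{|\<alpha>, \<beta>|}"] by simp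
qed

lemma nabla_bot: "derivable ({|\<^bold>\<nabla> \<^bold>\<bottom>|} \<rhd> {||})"
  using NablaL[of "\<^bold>\<bottom>" "{||}" "{||}"] BotL by simp

text \<open>This is the De Morgan dual of \<open>NablaEM\<close>. The two formulas are packed into
  one conjunction so that contraposition applies, and a cut with \<open>and_intro\<close> unpacks
  them at the end.\<close>

lemma nabla_contradiction: "derivable ({|\<^bold>\<nabla> \<alpha>, \<^bold>\<not> (\<^bold>\<nabla> \<alpha>)|} \<rhd> {||})"
proof -
  let ?c = "\<^bold>\<nabla> \<alpha> \<^bold>\<and> \<^bold>\<not> (\<^bold>\<nabla> \<alpha>)"
  have "\<^bold>\<nabla> \<alpha> \<^bold>\<or> \<^bold>\<not> (\<^bold>\<nabla> \<alpha>) \<turnstile> \<^bold>\<not> ?c"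
    by (intro or_entails entails_neg_swap[OF and_entails(2)] NegC and_entails(1))
  then have "?c \<turnstile> \<^bold>\<not> (\<^bold>\<nabla> \<alpha> \<^bold>\<or> \<^bold>\<not> (\<^bold>\<nabla> \<alpha>))"
    by (rule entails_neg_swap)
  moreover have "\<^bold>\<not> (\<^bold>\<nabla> \<alpha> \<^bold>\<or> \<^bold>\<not> (\<^bold>\<nabla> \<alpha>)) \<turnstile> \<^bold>\<bottom>"
    by (meson NegC WeakL NablaEM neg_top_entails entails_trans)
  ultimately have "?c \<turnstile> \<^bold>\<bottom>"
    by (rule entails_trans)
  then have "derivable ({|?c|} \<rhd> {||})"
    by (rule Cut) (auto intro: derivable_weaken[OF BotL])
  then show ?thesis
    by (rule Cut[of _ ?c, rotated, OF derivable_weaken]) (auto intro: and_intro)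
qed

section \<open>Prime theories\<close>

text \<open>Succedents with no, one and two formulas give consistency, deductive closure and
  primeness in a single condition.\<close>

definition prime_theory :: "form set \<Rightarrow> bool" where
  "prime_theory P \<longleftrightarrow>
     (\<forall>\<Gamma> \<Delta>. derivable (\<Gamma> \<rhd> \<Delta>) \<longrightarrow> fset \<Gamma> \<subseteq> P \<longrightarrow> fset \<Delta> \<inter> P \<noteq> {})"

section \<open>Maximal sets that avoid a succedent\<close>

definition avoids :: "form fset \<Rightarrow> form set \<Rightarrow> bool" where
  "avoids \<Sigma> T \<longleftrightarrow> (\<forall>\<Gamma>. fset \<Gamma> \<subseteq> T \<longrightarrow> \<not> derivable (\<Gamma> \<rhd> \<Sigma>))"

text \<open>An antecedent is finite, so it already lies in one member of the chain.\<close>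

lemma avoids_Union_chain:
  assumes "subset.chain {T. avoids \<Sigma> T} C" "C \<noteq> {}"
  shows "avoids \<Sigma> (\<Union>C)"
  unfolding avoids_def
proof (intro allI impI)
  fix \<Gamma> assume "fset \<Gamma> \<subseteq> \<Union>C"
  then obtain T where "T \<in> C" "fset \<Gamma> \<subseteq> T"
    using finite_subset_Union_chain[OF finite_fset _ assms(2,1)] by blast
  then show "\<not> derivable (\<Gamma> \<rhd> \<Sigma>)"
    using assms(1) by (auto simp: avoids_def subset_chain_def)
qed

lemma avoids_maximal_prime:
  assumes avoids: "avoids \<Sigma> P"
    and maximal: "\<And>T. avoids \<Sigma> T \<Longrightarrow> P \<subseteq> T \<Longrightarrow> T = P"
  shows "prime_theory P"
proof -
  \<comment> \<open>Carrying \<open>\<Sigma>\<close> along in the succedent lets the formulas of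
    \<open>\<Delta>\<close> outside \<open>P\<close> be cut away one at a time, until
    \<open>\<Sigma>\<close> alone remains and contradicts avoidance.\<close>
  have "derivable (\<Gamma> \<rhd> \<Delta> |\<union>| \<Sigma>) \<Longrightarrow> fset \<Gamma> \<subseteq> P \<Longrightarrow> fset \<Delta> \<inter> P \<noteq> {}" for \<Gamma> \<Delta>
  proof (induction \<Delta> arbitrary: \<Gamma>)
    case empty
    then show ?case
      using avoids by (simp add: avoids_def)
  next
    case (insert \<delta> \<Delta>)
    show ?case
    proof (cases "\<delta> \<in> P")
      case False
      then have "\<not> avoids \<Sigma> (insert \<delta> P)"
        using maximal[of "insert \<delta> P"] by auto
      then obtain \<Theta> where \<Theta>: "fset \<Theta> \<subseteq> insert \<delta> P" "derivable (\<Theta> \<rhd> \<Sigma>)"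
        by (auto simp: avoids_def)
      \<comment> \<open>Removing the cut formula from \<open>\<Theta>\<close> leaves only members of
        \<open>P\<close>, as the induction hypothesis requires.\<close>
      define \<Gamma>' where "\<Gamma>' = (\<Theta> |-| {|\<delta>|}) |\<union>| \<Gamma>"
      have "derivable (\<Gamma>' \<rhd> \<Delta> |\<union>| \<Sigma>)"
      proof (rule Cut[of _ \<delta>])
        show "derivable (\<Gamma>' \<rhd> finsert \<delta> (\<Delta> |\<union>| \<Sigma>))"
          by (rule derivable_weaken[OF insert.prems(1)]) (auto simp: \<Gamma>'_def)
        show "derivable (finsert \<delta> \<Gamma>' \<rhd> \<Delta> |\<union>| \<Sigma>)"
          by (rule derivable_weaken[OF \<Theta>(2)]) (auto simp: \<Gamma>'_def)
      qed
      moreover have "fset \<Gamma>' \<subseteq> P"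
        using \<Theta>(1) insert.prems(2) by (auto simp: \<Gamma>'_def)
      ultimately show ?thesis
        using insert.IH by auto
    qed auto
  qed
  then show ?thesis
    unfolding prime_theory_def by (meson derivable_weaken fsubset_refl sup_ge1)
qed

lemma prime_theory_exists:
  assumes "\<not> derivable (\<Gamma> \<rhd> \<Sigma>)"
  obtains P where "prime_theory P" "fset \<Gamma> \<subseteq> P" "fset \<Sigma> \<inter> P = {}"
proof -
  define \<A> where "\<A> = {T. avoids \<Sigma> T \<and> fset \<Gamma> \<subseteq> T}"
  have "fset \<Gamma> \<in> \<A>"
    using assms derivable_weaken[OF _ _ fsubset_refl]
    by (metis (mono_tags, lifting) \<A>_def avoids_def less_eq_fset.rep_eq mem_Collect_eq subset_refl)
  moreover have "\<Union>C \<in> \<A>" if "C \<noteq> {}" "subset.chain \<A> C" for C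
  proof -
    have "subset.chain {T. avoids \<Sigma> T} C"
      using that(2) by (auto simp: subset_chain_def \<A>_def)
    then have "avoids \<Sigma> (\<Union>C)"
      using that(1) by (rule avoids_Union_chain)
    moreover have "fset \<Gamma> \<subseteq> \<Union>C"
      using that unfolding subset_chain_def \<A>_def by blast
    ultimately show ?thesis
      by (simp add: \<A>_def)
  qed
  ultimately obtain P where P: "P \<in> \<A>" "\<forall>T\<in>\<A>. P \<subseteq> T \<longrightarrow> T = P"
    using subset_Zorn_nonempty[of \<A>] by blast
  show thesis
  proof (rule that)
    show "prime_theory P"
      \<comment> \<open>Every superset of \<open>P\<close> contains \<open>\<Gamma>\<close>, so
        maximality within \<open>\<A>\<close> is maximality among all avoiding sets.\<close>
      by (rule avoids_maximal_prime[of \<Sigma>]) (use P in \<open>auto simp: \<A>_def\<close>)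
    show "fset \<Gamma> \<subseteq> P"
      using P(1) by (simp add: \<A>_def)
    show "fset \<Sigma> \<inter> P = {}"
    proof (rule ccontr)
      assume "fset \<Sigma> \<inter> P \<noteq> {}"
      then obtain \<alpha> where "\<alpha> |\<in>| \<Sigma>" "fset {|\<alpha>|} \<subseteq> P"
        by auto
      then show False
        using P(1) derivable_common[of \<alpha> "{|\<alpha>|}" \<Sigma>] by (auto simp: \<A>_def avoids_def)
    qed
  qed
qed

section \<open>The homomorphism of a prime theory\<close>

text \<open>
  The arguments stand for membership of \<open>\<alpha>\<close>, \<open>\<not>\<alpha>\<close>, \<open>\<nabla>\<alpha>\<close> and \<open>\<nabla>\<not>\<alpha>\<close> in \<open>P\<close>, so that
  \<open>\<not> n\<close> says \<open>\<alpha> \<in> P\<^sup>*\<close> and \<open>\<not> r\<close> says \<open>\<alpha> \<in> Q\<^sup>*\<close>.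
\<close>

definition pattern_value :: "bool \<Rightarrow> bool \<Rightarrow> bool \<Rightarrow> bool \<Rightarrow> s6" where
  "pattern_value p n q r =
     (if \<not> r then One else if p then (if n then N else TwoThirds)
      else if \<not> n then B else if q then Third else Zero)"

text \<open>The conditions on each pattern encode the inclusions between \<open>P\<close>,
  \<open>Q\<close> and their stars. Exactly six patterns satisfy them, one for each element of the
  algebra. By De Morgan the negated coordinates combine dually.\<close>

lemma pattern_value_inf:
  assumes "p \<longrightarrow> q" "n \<longrightarrow> r" "r \<or> p" "q \<or> n" "p' \<longrightarrow> q'" "n' \<longrightarrow> r'" "r' \<or> p'" "q' \<or> n'"
  shows "pattern_value (p \<and> p') (n \<or> n') (q \<and> q') (r \<or> r') =
    inf (pattern_value p n q r) (pattern_value p' n' q' r')"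
  using assms
  by (cases p; cases n; cases p'; cases n';
      simp add: pattern_value_def inf_s6_def less_eq_s6_def)

lemma pattern_value_sup:
  assumes "p \<longrightarrow> q" "n \<longrightarrow> r" "r \<or> p" "q \<or> n" "p' \<longrightarrow> q'" "n' \<longrightarrow> r'" "r' \<or> p'" "q' \<or> n'"
  shows "pattern_value (p \<or> p') (n \<and> n') (q \<or> q') (r \<and> r') =
    sup (pattern_value p n q r) (pattern_value p' n' q' r')"
  using assms
  by (cases p; cases n; cases p'; cases n';
      simp add: pattern_value_def sup_s6_def less_eq_s6_def)

definition theory_hom :: "form set \<Rightarrow> form \<Rightarrow> s6" where
  "theory_hom P \<alpha> =
     pattern_value (\<alpha> \<in> P) (\<^bold>\<not> \<alpha> \<in> P) (\<^bold>\<nabla> \<alpha> \<in> P) (\<^bold>\<nabla> (\<^bold>\<not> \<alpha>) \<in> P)"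

context
  fixes P :: "form set"
  assumes prime: "prime_theory P"
begin

section \<open>Membership of compound formulas\<close>

lemma prime_theoryD: "derivable (\<Gamma> \<rhd> \<Delta>) \<Longrightarrow> fset \<Gamma> \<subseteq> P \<Longrightarrow> \<exists>\<delta>. \<delta> |\<in>| \<Delta> \<and> \<delta> \<in> P"
  using prime unfolding prime_theory_def by blast

lemma entails_mem: "\<alpha> \<turnstile> \<beta> \<Longrightarrow> \<alpha> \<in> P \<Longrightarrow> \<beta> \<in> P"
  using prime_theoryD[of "{|\<alpha>|}" "{|\<beta>|}"] by auto

lemma entails_mem2: "derivable ({|\<alpha>, \<beta>|} \<rhd> {|\<gamma>|}) \<Longrightarrow> \<alpha> \<in> P \<Longrightarrow> \<beta> \<in> P \<Longrightarrow> \<gamma> \<in> P"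
  using prime_theoryD[of "{|\<alpha>, \<beta>|}" "{|\<gamma>|}"] by auto

lemma entails_mem_disj: "derivable ({|\<alpha>|} \<rhd> {|\<beta>, \<gamma>|}) \<Longrightarrow> \<alpha> \<in> P \<Longrightarrow> \<beta> \<in> P \<or> \<gamma> \<in> P"
  using prime_theoryD[of "{|\<alpha>|}" "{|\<beta>, \<gamma>|}"] by auto

lemma equiv_mem: "\<alpha> \<turnstile> \<beta> \<Longrightarrow> \<beta> \<turnstile> \<alpha> \<Longrightarrow> \<alpha> \<in> P \<longleftrightarrow> \<beta> \<in> P"
  using entails_mem by blast

lemma bot_mem: "\<^bold>\<bottom> \<notin> P"
  using prime_theoryD[OF BotL] by auto

lemma top_mem: "\<^bold>\<top> \<in> P"
  using prime_theoryD[OF TopR] by auto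

lemma and_mem: "\<alpha> \<^bold>\<and> \<beta> \<in> P \<longleftrightarrow> \<alpha> \<in> P \<and> \<beta> \<in> P"
  using entails_mem2[OF and_intro[of \<alpha> \<beta>]] entails_mem[OF and_entails(1)[of \<alpha> \<beta>]]
    entails_mem[OF and_entails(2)[of \<alpha> \<beta>]] by blast

lemma or_mem: "\<alpha> \<^bold>\<or> \<beta> \<in> P \<longleftrightarrow> \<alpha> \<in> P \<or> \<beta> \<in> P"
  using entails_mem_disj[OF or_elim[of \<alpha> \<beta>]] entails_mem[OF entails_or(1)[of \<alpha> \<beta>]]
    entails_mem[OF entails_or(2)[of \<beta> \<alpha>]] by blast

lemma nabla_and_mem: "\<^bold>\<nabla> (\<alpha> \<^bold>\<and> \<beta>) \<in> P \<longleftrightarrow> \<^bold>\<nabla> \<alpha> \<in> P \<and> \<^bold>\<nabla> \<beta> \<in> P"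
  using entails_mem2[OF nabla_and_intro[of \<alpha> \<beta>]]
    entails_mem[OF nabla_mono[OF and_entails(1)[of \<alpha> \<beta>]]]
    entails_mem[OF nabla_mono[OF and_entails(2)[of \<alpha> \<beta>]]] by blast

lemma nabla_or_mem: "\<^bold>\<nabla> (\<alpha> \<^bold>\<or> \<beta>) \<in> P \<longleftrightarrow> \<^bold>\<nabla> \<alpha> \<in> P \<or> \<^bold>\<nabla> \<beta> \<in> P"
  using entails_mem_disj[OF nabla_or_elim[of \<alpha> \<beta>]]
    entails_mem[OF nabla_mono[OF entails_or(1)[of \<alpha> \<beta>]]]
    entails_mem[OF nabla_mono[OF entails_or(2)[of \<beta> \<alpha>]]] by blast

lemma mem_nabla: "\<alpha> \<in> P \<Longrightarrow> \<^bold>\<nabla> \<alpha> \<in> P"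
  by (rule entails_mem[OF AxNabla])

lemma nabla_bot_mem: "\<^bold>\<nabla> \<^bold>\<bottom> \<notin> P"
  using prime_theoryD[OF nabla_bot] by auto

lemma neg_top_mem: "\<^bold>\<not> \<^bold>\<top> \<notin> P" "\<^bold>\<nabla> (\<^bold>\<not> \<^bold>\<top>) \<notin> P"
  using entails_mem[OF neg_top_entails] entails_mem[OF nabla_mono[OF neg_top_entails]]
    bot_mem nabla_bot_mem by auto

lemma neg_bot_mem: "\<^bold>\<not> \<^bold>\<bottom> \<in> P"
  by (rule entails_mem[OF entails_neg_bot top_mem])

lemma neg_neg_mem:
  "\<^bold>\<not> (\<^bold>\<not> \<alpha>) \<in> P \<longleftrightarrow> \<alpha> \<in> P" "\<^bold>\<nabla> (\<^bold>\<not> (\<^bold>\<not> \<alpha>)) \<in> P \<longleftrightarrow> \<^bold>\<nabla> \<alpha> \<in> P"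
  by (intro equiv_mem nabla_mono neg_neg_entails entails_neg_neg)+

lemma neg_and_mem:
  "\<^bold>\<not> (\<alpha> \<^bold>\<and> \<beta>) \<in> P \<longleftrightarrow> \<^bold>\<not> \<alpha> \<in> P \<or> \<^bold>\<not> \<beta> \<in> P"
  "\<^bold>\<nabla> (\<^bold>\<not> (\<alpha> \<^bold>\<and> \<beta>)) \<in> P \<longleftrightarrow> \<^bold>\<nabla> (\<^bold>\<not> \<alpha>) \<in> P \<or> \<^bold>\<nabla> (\<^bold>\<not> \<beta>) \<in> P"
proof -
  have "\<^bold>\<not> \<alpha> \<^bold>\<or> \<^bold>\<not> \<beta> \<turnstile> \<^bold>\<not> (\<alpha> \<^bold>\<and> \<beta>)"
    by (intro or_entails NegC and_entails)
  note equiv = neg_and_entails this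
  show "\<^bold>\<not> (\<alpha> \<^bold>\<and> \<beta>) \<in> P \<longleftrightarrow> \<^bold>\<not> \<alpha> \<in> P \<or> \<^bold>\<not> \<beta> \<in> P"
    using equiv_mem[OF equiv] by (simp add: or_mem)
  show "\<^bold>\<nabla> (\<^bold>\<not> (\<alpha> \<^bold>\<and> \<beta>)) \<in> P \<longleftrightarrow> \<^bold>\<nabla> (\<^bold>\<not> \<alpha>) \<in> P \<or> \<^bold>\<nabla> (\<^bold>\<not> \<beta>) \<in> P"
    using equiv_mem[OF equiv[THEN nabla_mono]] by (simp add: nabla_or_mem)
qed

lemma neg_or_mem:
  "\<^bold>\<not> (\<alpha> \<^bold>\<or> \<beta>) \<in> P \<longleftrightarrow> \<^bold>\<not> \<alpha> \<in> P \<and> \<^bold>\<not> \<beta> \<in> P"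
  "\<^bold>\<nabla> (\<^bold>\<not> (\<alpha> \<^bold>\<or> \<beta>)) \<in> P \<longleftrightarrow> \<^bold>\<nabla> (\<^bold>\<not> \<alpha>) \<in> P \<and> \<^bold>\<nabla> (\<^bold>\<not> \<beta>) \<in> P"
proof -
  have "\<^bold>\<not> (\<alpha> \<^bold>\<or> \<beta>) \<turnstile> \<^bold>\<not> \<alpha> \<^bold>\<and> \<^bold>\<not> \<beta>"
    by (intro entails_and NegC entails_or)
  note equiv = this entails_neg_or
  show "\<^bold>\<not> (\<alpha> \<^bold>\<or> \<beta>) \<in> P \<longleftrightarrow> \<^bold>\<not> \<alpha> \<in> P \<and> \<^bold>\<not> \<beta> \<in> P"
    using equiv_mem[OF equiv] by (simp add: and_mem)
  show "\<^bold>\<nabla> (\<^bold>\<not> (\<alpha> \<^bold>\<or> \<beta>)) \<in> P \<longleftrightarrow> \<^bold>\<nabla> (\<^bold>\<not> \<alpha>) \<in> P \<and> \<^bold>\<nabla> (\<^bold>\<not> \<beta>) \<in> P"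
    using equiv_mem[OF equiv[THEN nabla_mono]] by (simp add: nabla_and_mem)
qed

text \<open>Nabla formulas behave classically: \<open>NablaEM\<close> excludes a gap and
  \<open>nabla_contradiction\<close> a glut.\<close>

lemma neg_nabla_mem: "\<^bold>\<not> (\<^bold>\<nabla> \<alpha>) \<in> P \<longleftrightarrow> \<^bold>\<nabla> \<alpha> \<notin> P"
  using prime_theoryD[OF nabla_contradiction[of \<alpha>]] prime_theoryD[OF NablaEM[of \<alpha>]] or_mem
  by auto

lemma nabla_nabla_mem: "\<^bold>\<nabla> (\<^bold>\<nabla> \<alpha>) \<in> P \<longleftrightarrow> \<^bold>\<nabla> \<alpha> \<in> P"
  by (intro equiv_mem nabla_entails Ax AxNabla)

lemma nabla_neg_nabla_mem: "\<^bold>\<nabla> (\<^bold>\<not> (\<^bold>\<nabla> \<alpha>)) \<in> P \<longleftrightarrow> \<^bold>\<nabla> \<alpha> \<notin> P"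
  using equiv_mem[OF NegNablaL[OF Ax] AxNabla] neg_nabla_mem by blast

text \<open>This is the inclusion of the star of \<open>Q\<close> in \<open>P\<close>, from
  contraposing \<open>AxNabla\<close> at the negation of \<open>\<alpha>\<close>.\<close>

lemma nabla_neg_or_mem: "\<^bold>\<nabla> (\<^bold>\<not> \<alpha>) \<in> P \<or> \<alpha> \<in> P"
  using entails_mem[OF neg_entails_swap[OF AxNabla]] neg_nabla_mem by blast

text \<open>This is the inclusion of the star of \<open>P\<close> in \<open>Q\<close>, from
  contraposing \<open>AxNabla\<close> at \<open>\<alpha>\<close>.\<close>

lemma nabla_or_neg_mem: "\<^bold>\<nabla> \<alpha> \<in> P \<or> \<^bold>\<not> \<alpha> \<in> P"
  using entails_mem[OF NegC[OF AxNabla]] neg_nabla_mem by blast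

lemma hom_theory_hom: "hom (theory_hom P)"
  unfolding hom_def
proof (intro conjI allI)
  show "theory_hom P \<^bold>\<bottom> = Zero"
    using mem_nabla[OF neg_bot_mem]
    by (simp add: theory_hom_def pattern_value_def bot_mem nabla_bot_mem neg_bot_mem)
  show "theory_hom P \<^bold>\<top> = One"
    by (simp add: theory_hom_def pattern_value_def neg_top_mem)
next
  fix \<alpha>
  \<comment> \<open>Up to double negation, negating swaps the first two coordinates of the pattern
    and the last two.\<close>
  show "theory_hom P (\<^bold>\<not> \<alpha>) = neg_s6 (theory_hom P \<alpha>)"
    using mem_nabla[of \<alpha>] mem_nabla[of "\<^bold>\<not> \<alpha>"] nabla_neg_or_mem[of \<alpha>] nabla_or_neg_mem[of \<alpha>]
    by (auto simp: theory_hom_def pattern_value_def neg_neg_mem)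
  \<comment> \<open>With \<open>q\<close> for membership of the nabla formula, its own pattern is
    \<open>q, \<not> q, q, \<not> q\<close>, whose value is \<open>One\<close> or
    \<open>Zero\<close>. The inclusions make \<open>q\<close> fail exactly when the value of
    \<open>\<alpha>\<close> is \<open>Zero\<close>.\<close>
  show "theory_hom P (\<^bold>\<nabla> \<alpha>) = nabla_s6 (theory_hom P \<alpha>)"
    using mem_nabla[of \<alpha>] nabla_neg_or_mem[of \<alpha>] nabla_or_neg_mem[of \<alpha>]
    by (auto simp: theory_hom_def pattern_value_def nabla_s6_def neg_nabla_mem nabla_nabla_mem nabla_neg_nabla_mem)
next
  fix \<alpha> \<beta>
  show "theory_hom P (\<alpha> \<^bold>\<and> \<beta>) = inf (theory_hom P \<alpha>) (theory_hom P \<beta>)"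
    unfolding theory_hom_def and_mem nabla_and_mem neg_and_mem
    by (rule pattern_value_inf)
      (simp_all add: mem_nabla nabla_neg_or_mem nabla_or_neg_mem)
  show "theory_hom P (\<alpha> \<^bold>\<or> \<beta>) = sup (theory_hom P \<alpha>) (theory_hom P \<beta>)"
    unfolding theory_hom_def or_mem nabla_or_mem neg_or_mem
    by (rule pattern_value_sup)
      (simp_all add: mem_nabla nabla_neg_or_mem nabla_or_neg_mem)
qed

section \<open>Separation of \<open>P\<close> from its complement\<close>

lemma N_le_theory_hom: "\<alpha> \<in> P \<Longrightarrow> N \<le> theory_hom P \<alpha>"
  by (simp add: theory_hom_def pattern_value_def less_eq_s6_def)

text \<open>The value \<open>One\<close> would put \<open>\<alpha>\<close> in the star of
  \<open>Q\<close>, hence in \<open>P\<close>; the other values for a formula outside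
  \<open>P\<close> are \<open>B\<close>, \<open>Third\<close> and \<open>Zero\<close>.\<close>

lemma theory_hom_le_B: "\<alpha> \<notin> P \<Longrightarrow> theory_hom P \<alpha> \<le> B"
  using nabla_neg_or_mem[of \<alpha>] by (auto simp: theory_hom_def pattern_value_def less_eq_s6_def)

end

theorem mainTheorem19:
  fixes \<Gamma> \<Sigma> :: "form fset"
  assumes "valid (\<Gamma> \<rhd> \<Sigma>)"
  shows "derivable (\<Gamma> \<rhd> \<Sigma>)"
proof (rule ccontr)
  assume "\<not> derivable (\<Gamma> \<rhd> \<Sigma>)"
  then obtain P where P: "prime_theory P" "fset \<Gamma> \<subseteq> P" "fset \<Sigma> \<inter> P = {}"
    by (rule prime_theory_exists)
  let ?h = "theory_hom P"
  have hom: "hom ?h"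
    by (rule hom_theory_hom[OF P(1)])
  have "N \<le> ?h (Conj \<Gamma>)"
    using P(2) N_le_theory_hom[OF P(1)] by (auto simp: le_hom_Conj_iff[OF hom])
  also have "\<dots> \<le> ?h (Disj \<Sigma>)"
    using assms hom by simp
  also have "\<dots> \<le> B"
    using P(3) theory_hom_le_B[OF P(1)] by (auto simp: hom_Disj_le_iff[OF hom])
  finally show False
    by (simp add: less_eq_s6_def)
qed

end
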